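(* Let $x \in \mathbb{R}^r\setminus \mathbb{R}^r_{\rm alt}$ with all $x_i \neq 0$, and let $A_r\in \mathbb{R}^{r \times r}$ be a $TN_{r-1}$ matrix. Then: (1) $S^-(A_rx) \leq S^-(x)$. If moreover equality holds and $A_rx \neq 0$, then the first (respectively, last) nonzero component of $A_rx$ has the same sign as the first (respectively, last) component of $x$. (2) There exists a coordinate $i \in \{1,\ldots,r\}$ such that $x_i(A_rx)_i\geq0$.
   Context: A real matrix is $TN_k$ (totally non-negative of order $k$) if all its minors of order at most $k$ are non-negative. $\mathbb{R}^r_{\rm alt}\subset\mathbb{R}^r$ is the set of real vectors with all coordinates nonzero and with alternating signs (consecutive coordinates have opposite signs). For $v\in\mathbb{R}^p$, $S^-(v)$ is the number of sign changes in the sequence of coordinates of $v$ after deleting all zero entries, with $S^-(0):=0$. *)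

theory Defs
  imports
    Complex_Main
    "Jordan_Normal_Form.Determinant"
    "Jordan_Normal_Form.DL_Submatrix"
begin

text \<open>A minor is given by its row set \<open>I\<close> and column set \<open>J\<close>, of equal size;
  \<^const>\<open>submatrix\<close> keeps both in increasing order. The empty minor equals 1, so admitting
  \<open>I = J = {}\<close> imposes nothing.\<close>

definition totally_nonneg :: "nat \<Rightarrow> real mat \<Rightarrow> bool" where
  "totally_nonneg k A \<longleftrightarrow>
     (\<forall>I J. I \<subseteq> {..<dim_row A} \<and> J \<subseteq> {..<dim_col A} \<and> card I = card J \<and> card I \<le> k
        \<longrightarrow> det (submatrix A I J) \<ge> 0)"

definition alt_vecs :: "nat \<Rightarrow> real vec set" where
  "alt_vecs r = {v \<in> carrier_vec r.
     (\<forall>i<r. v $ i \<noteq> 0) \<and> (\<forall>i. Suc i < r \<longrightarrow> sgn (v $ Suc i) = - sgn (v $ i))}"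

definition nonzeros :: "real vec \<Rightarrow> real list" where
  "nonzeros v = filter (\<lambda>a. a \<noteq> 0) (list_of_vec v)"

definition S_minus :: "real vec \<Rightarrow> nat" where
  "S_minus v = card {i. Suc i < length (nonzeros v) \<and>
     sgn (nonzeros v ! i) \<noteq> sgn (nonzeros v ! Suc i)}"

end

theory Submission
  imports Defs
begin

text \<open>Sign changes are tracked through alternating subsequences. If \<open>C\<close> has nonnegative minors and
  \<open>C d = y\<close> has alternating nonzero entries, then \<open>d\<close> contains a subsequence with exactly the signs
  of \<open>y\<close>. While the columns are dependent, move \<open>d\<close> along the kernel until a coordinate first
  becomes zero: no other coordinate changes sign, \<open>y\<close> stays the same, and a column can be dropped.
  When \<open>C\<close> is square and nonsingular, Cramer's rule gives \<open>d\<close> the signs of \<open>y\<close>. If \<open>C\<close> has fewer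
  columns than rows, two overlapping blocks of consecutive rows force opposite signs on the same
  coordinate of \<open>d\<close>.

  Only minors of order at most the number of rows occur, so the argument applies to all alternating
  selections of at most \<open>r - 1\<close> entries of \<open>A x\<close>. Part (2) follows from part (1): if
  \<open>x\<^sub>i (A x)\<^sub>i < 0\<close> for all \<open>i\<close>, then \<open>A x\<close> has as many sign changes as \<open>x\<close> but the opposite first
  sign.\<close>

section \<open>Nonnegative minors and alternating sign patterns\<close>

text \<open>Rows and columns are chosen by strictly increasing maps rather than sets, so that
  passing to a submatrix is composition of maps. The order \<open>l\<close> is bounded implicitly by
  \<open>p\<close> and \<open>n\<close>.\<close>

definition minors_nonneg :: "nat \<Rightarrow> nat \<Rightarrow> (nat \<Rightarrow> nat \<Rightarrow> real) \<Rightarrow> bool" where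
  "minors_nonneg p n C \<longleftrightarrow>
     (\<forall>l f g. strict_mono_on {..<l} f \<and> f ` {..<l} \<subseteq> {..<p} \<and>
        strict_mono_on {..<l} g \<and> g ` {..<l} \<subseteq> {..<n}
        \<longrightarrow> 0 \<le> det (mat l l (\<lambda>(i, j). C (f i) (g j))))"

definition alternating :: "nat \<Rightarrow> (nat \<Rightarrow> real) \<Rightarrow> bool" where
  "alternating p y \<longleftrightarrow>
     (\<forall>i<p. y i \<noteq> 0) \<and> (\<forall>i. Suc i < p \<longrightarrow> sgn (y (Suc i)) = - sgn (y i))"

lemma minors_nonneg_select:
  assumes C: "minors_nonneg p n C"
    and f: "strict_mono_on {..<p'} f" "f ` {..<p'} \<subseteq> {..<p}"
    and g: "strict_mono_on {..<n'} g" "g ` {..<n'} \<subseteq> {..<n}"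
  shows "minors_nonneg p' n' (\<lambda>i j. C (f i) (g j))"
  unfolding minors_nonneg_def
proof (intro allI impI, elim conjE)
  fix l :: nat and f' g'
  assume f': "strict_mono_on {..<l} f'" "f' ` {..<l} \<subseteq> {..<p'}"
    and g': "strict_mono_on {..<l} g'" "g' ` {..<l} \<subseteq> {..<n'}"
  have "strict_mono_on {..<l} (f \<circ> f')" "(f \<circ> f') ` {..<l} \<subseteq> {..<p}"
    using f f' by (auto simp: strict_mono_on_def image_subset_iff)
  moreover have "strict_mono_on {..<l} (g \<circ> g')" "(g \<circ> g') ` {..<l} \<subseteq> {..<n}"
    using g g' by (auto simp: strict_mono_on_def image_subset_iff)
  ultimately have "0 \<le> det (mat l l (\<lambda>(i, j). C ((f \<circ> f') i) ((g \<circ> g') j)))"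
    using C unfolding minors_nonneg_def by blast
  then show "0 \<le> det (mat l l (\<lambda>(i, j). C (f (f' i)) (g (g' j))))" by simp
qed

lemma alternating_sgn:
  assumes "alternating p y" "i < p"
  shows "sgn (y i) = (-1) ^ i * sgn (y 0)"
  using assms(2)
proof (induction i)
  case (Suc i)
  then show ?case using assms(1) by (simp add: alternating_def)
qed simp

lemma strict_mono_on_ge:
  fixes f :: "nat \<Rightarrow> nat"
  assumes "strict_mono_on {..<l} f" "i < l"
  shows "i \<le> f i"
  using assms(2)
proof (induction i)
  case (Suc i)
  then have "f i < f (Suc i)" using assms(1) by (simp add: strict_mono_on_def)
  with Suc show ?case by simp
qed simp

text \<open>Counting down from the top index gives \<open>f i \<le> i\<close>, counting up gives the
  reverse bound. Hence a selection of \<open>n\<close> out of \<open>n\<close> columns leaves no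
  freedom.\<close>

lemma strict_mono_on_eq_id:
  fixes f :: "nat \<Rightarrow> nat"
  assumes f: "strict_mono_on {..<l} f" "f ` {..<l} \<subseteq> {..<l}" and "i < l"
  shows "f i = i"
proof -
  have "f (l - Suc k) \<le> l - Suc k" if "k < l" for k
    using that
  proof (induction k)
    case 0
    then have "f (l - 1) < l" using f(2) by (auto simp: image_subset_iff)
    then show ?case using 0 by simp
  next
    case (Suc k)
    then have "f (l - Suc (Suc k)) < f (l - Suc k)" using f(1)
      by (simp add: strict_mono_on_def)
    with Suc show ?case by simp
  qed
  from this[of "l - Suc i"] \<open>i < l\<close> have "f i \<le> i" by simp
  with strict_mono_on_ge[OF f(1) \<open>i < l\<close>] show ?thesis by simp
qed

section \<open>Linear systems: moving along the kernel, and Cramer's rule\<close>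

text \<open>Take \<open>t = d z / e z\<close> where this ratio is least in absolute value among the
  indices with \<open>e j \<noteq> 0\<close>. Then \<open>t * e j\<close> never exceeds
  \<open>d j\<close> in absolute value, so no coordinate crosses zero.\<close>

lemma shift_to_zero:
  fixes d e :: "'a \<Rightarrow> real"
  assumes "finite J" "j0 \<in> J" "e j0 \<noteq> 0"
  obtains t z where "z \<in> J" "d z - t * e z = 0"
    "\<And>j. j \<in> J \<Longrightarrow> d j - t * e j \<noteq> 0 \<Longrightarrow> sgn (d j - t * e j) = sgn (d j)"
proof -
  let ?K = "{j \<in> J. e j \<noteq> 0}"
  define q where "q j = \<bar>d j / e j\<bar>" for j
  have K: "finite ?K" "?K \<noteq> {}" using assms by auto
  define z where "z = arg_min_on q ?K"
  have zK: "z \<in> ?K" unfolding z_def by (rule arg_min_if_finite(1)[OF K])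
  have zmin: "q z \<le> q j" if "j \<in> ?K" for j
    using arg_min_least[OF K that, of q] unfolding z_def .
  define t where "t = d z / e z"
  have "sgn (d j - t * e j) = sgn (d j)" if j: "j \<in> J" "d j - t * e j \<noteq> 0" for j
  proof -
    have "\<bar>t * e j\<bar> \<le> \<bar>d j\<bar>"
    proof (cases "e j = 0")
      case False
      then have "\<bar>t\<bar> \<le> \<bar>d j\<bar> / \<bar>e j\<bar>" using zmin[of j] j by (simp add: q_def t_def)
      with False show ?thesis by (simp add: abs_mult field_simps)
    qed simp
    with j(2) show ?thesis by (auto simp: sgn_if abs_if split: if_splits)
  qed
  moreover have "d z - t * e z = 0" using zK by (simp add: t_def)
  ultimately show ?thesis using that zK by blast
qed

lemma singular_columns:
  fixes C :: "nat \<Rightarrow> nat \<Rightarrow> real"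
  assumes "p < n \<or> p = n \<and> det (mat n n (\<lambda>(i, j). C i j)) = 0"
  obtains e j where "\<And>i. i < p \<Longrightarrow> (\<Sum>j<n. C i j * e j) = 0" "j < n" "e j \<noteq> 0"
proof -
  \<comment> \<open>Padding to a square matrix: for \<open>p < n\<close> the last row is replaced by
    zero, which makes the determinant vanish and leaves the first \<open>p\<close> rows
    intact.\<close>
  define M where "M = mat\<^sub>r n n (\<lambda>i. if i = n - 1 \<and> p < n then 0\<^sub>v n else vec n (\<lambda>j. C i j))"
  have M: "M \<in> carrier_mat n n" by (simp add: M_def)
  have "det M = 0"
  proof (cases "p < n")
    case True
    then show ?thesis using det_row_0[of "n - 1" n "\<lambda>i. vec n (\<lambda>j. C i j)"]
      by (simp add: M_def)
  next
    case False
    then have "M = mat n n (\<lambda>(i, j). C i j)" by (auto simp: M_def intro!: eq_matI)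
    with False assms show ?thesis by simp
  qed
  then obtain v where v: "v \<in> carrier_vec n" "v \<noteq> 0\<^sub>v n" "M *\<^sub>v v = 0\<^sub>v n"
    using det_0_iff_vec_prod_zero[OF M] by blast
  have "(\<Sum>j<n. C i j * v $ j) = 0" if "i < p" for i
  proof -
    have i: "i < n" "\<not> (i = n - 1 \<and> p < n)" using that assms by auto
    then have "0 = (M *\<^sub>v v) $ i" using v(3) by simp
    also have "\<dots> = (\<Sum>j<n. C i j * v $ j)"
      using i v(1) by (auto simp: M_def scalar_prod_def lessThan_atLeast0 intro!: sum.cong)
    finally show ?thesis by simp
  qed
  moreover obtain j where "j < n" "v $ j \<noteq> 0" using v(1,2) by (metis eq_vecI carrier_vecD index_zero_vec)
  ultimately show ?thesis using that by blast
qed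

text \<open>Cramer's rule: the inverse of a matrix with nonnegative minors has the sign pattern of a
  chessboard.\<close>

lemma sgn_solution_nonsingular:
  assumes C: "minors_nonneg n n C"
    and det: "det (mat n n (\<lambda>(i, j). C i j)) \<noteq> 0"
    and eq: "\<And>i. i < n \<Longrightarrow> (\<Sum>j<n. C i j * d j) = y i"
    and y: "alternating n y"
    and j: "j < n" "d j \<noteq> 0"
  shows "sgn (d j) = sgn (y j)"
proof -
  define M where "M = mat n n (\<lambda>(i, j). C i j)"
  have M: "M \<in> carrier_mat n n" by (simp add: M_def)
  have "0 \<le> det M"
    using C[unfolded minors_nonneg_def, rule_format, of n id id]
    by (simp add: M_def strict_mono_on_def)
  with det have detM: "0 < det M" by (simp add: M_def)
  have Md: "M *\<^sub>v vec n d = vec n y"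
    using eq by (auto simp: M_def scalar_prod_def lessThan_atLeast0 intro!: eq_vecI)
  have "det M \<cdot>\<^sub>v vec n d = (adj_mat M * M) *\<^sub>v vec n d"
    unfolding adj_mat(3)[OF M]
    by (intro eq_vecI) (simp_all add: smult_scalar_prod_distrib[of _ n])
  also have "\<dots> = adj_mat M *\<^sub>v vec n y"
    by (subst assoc_mult_mat_vec[OF adj_mat(1)[OF M] M]) (simp_all add: Md)
  finally have "(det M \<cdot>\<^sub>v vec n d) $ j = (adj_mat M *\<^sub>v vec n y) $ j" by simp
  then have dj: "det M * d j = (\<Sum>i<n. cofactor M i j * y i)"
    using M j by (simp add: adj_mat_def scalar_prod_def lessThan_atLeast0)
  \<comment> \<open>Up to the factor \<open>(-1) ^ (i + j)\<close>, the cofactor is the minor with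
    row \<open>i\<close> and column \<open>j\<close> deleted.\<close>
  have cof: "0 \<le> (-1) ^ (i + j) * cofactor M i j" if i: "i < n" for i
  proof -
    have "mat_delete M i j = mat (n - 1) (n - 1) (\<lambda>(i', j'). C (insert_index i i') (insert_index j j'))"
      using M by (auto simp: mat_delete_def M_def insert_index_def intro!: eq_matI)
    moreover have "0 \<le> det (mat (n - 1) (n - 1) (\<lambda>(i', j'). C (insert_index i i') (insert_index j j')))"
      by (rule C[unfolded minors_nonneg_def, rule_format])
         (use i j in \<open>auto simp: strict_mono_on_def insert_index_def\<close>)
    ultimately show ?thesis
      by (simp add: cofactor_def flip: power_add mult.assoc power_mult_distrib)
  qed
  \<comment> \<open>Since \<open>y\<close> alternates,
    \<open>(-1) ^ (i + j) * sgn (y i) = sgn (y j)\<close>. Thus every term of the Cramer sum becomes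
    nonnegative after multiplication by \<open>sgn (y j)\<close>.\<close>
  have "0 \<le> (\<Sum>i<n. ((-1) ^ (i + j) * cofactor M i j) * \<bar>y i\<bar>)"
    by (intro sum_nonneg mult_nonneg_nonneg cof) auto
  also have "\<dots> = (\<Sum>i<n. (sgn (y j) * cofactor M i j) * y i)"
  proof (rule sum.cong[OF refl])
    fix i assume "i \<in> {..<n}"
    then have s: "sgn (y i) = (-1) ^ i * sgn (y 0)" "sgn (y j) = (-1) ^ j * sgn (y 0)"
      using alternating_sgn[OF y, of i] alternating_sgn[OF y j(1)] by simp_all
    have "(-1) ^ (i + j) * sgn (y i) = sgn (y j)"
      by (cases "even i"; cases "even j") (simp_all add: s)
    then show "((-1) ^ (i + j) * cofactor M i j) * \<bar>y i\<bar> = (sgn (y j) * cofactor M i j) * y i"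
      by (simp add: abs_sgn mult_ac flip: \<open>(-1) ^ (i + j) * sgn (y i) = sgn (y j)\<close>)
  qed
  also have "\<dots> = sgn (y j) * (det M * d j)"
    by (simp add: dj sum_distrib_left mult.assoc)
  finally have "0 \<le> det M * (sgn (y j) * d j)" by (simp add: mult_ac)
  then have "0 \<le> sgn (y j) * d j"
    using detM zero_le_mult_iff[of "det M" "sgn (y j) * d j"] by linarith
  moreover have "y j \<noteq> 0" using y j by (simp add: alternating_def)
  ultimately show ?thesis using j(2) by (auto simp: sgn_if zero_le_mult_iff split: if_splits)
qed

section \<open>The sign pattern of the image inside the preimage\<close>

lemma alternating_shift:
  assumes "alternating p y" "q \<le> p - k"
  shows "alternating q (\<lambda>i. y (k + i))"
  using assms by (auto simp: alternating_def)

text \<open>Induction on \<open>p + n\<close>: deleting a column lowers \<open>n\<close>, and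
  cutting a tall array down to \<open>n\<close> consecutive rows lowers \<open>p\<close>.\<close>

lemma alternating_product_pattern:
  fixes C :: "nat \<Rightarrow> nat \<Rightarrow> real"
  assumes "minors_nonneg p n C"
    and "\<And>i. i < p \<Longrightarrow> (\<Sum>j<n. C i j * d j) = y i"
    and "alternating p y"
  shows "\<exists>h. strict_mono_on {..<p} h \<and> h ` {..<p} \<subseteq> {..<n} \<and>
           (\<forall>i<p. sgn (d (h i)) = sgn (y i))"
  using assms
proof (induction "p + n" arbitrary: p n C d y rule: less_induct)
  case less
  note C = less.prems(1) and eq = less.prems(2) and y = less.prems(3)
  \<comment> \<open>A solution \<open>d'\<close> that vanishes at \<open>z\<close> allows column
    \<open>z\<close> to be deleted. The pattern then found uses only nonzero entries of
    \<open>d'\<close>, where the signs agree with those of \<open>d\<close>.\<close>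
  have drop: ?case if z: "z < n" "d' z = 0"
    and eq': "\<And>i. i < p \<Longrightarrow> (\<Sum>j<n. C i j * d' j) = y i"
    and d': "\<And>j. j < n \<Longrightarrow> d' j \<noteq> 0 \<Longrightarrow> sgn (d' j) = sgn (d j)" for d' z
  proof -
    obtain m where m: "n = Suc m" using z(1) by (cases n) auto
    let ?k = "insert_index z"
    have k: "strict_mono_on {..<m} ?k" "?k ` {..<m} = {..<n} - {z}" "inj_on ?k {..<m}"
      using insert_index_image[of z m] z(1) insert_index_inj_on
      by (auto simp: m lessThan_atLeast0 strict_mono_on_def insert_index_def)
    have "\<exists>h. strict_mono_on {..<p} h \<and> h ` {..<p} \<subseteq> {..<m} \<and>
        (\<forall>i<p. sgn (d' (?k (h i))) = sgn (y i))"
    proof (rule less.hyps)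
      show "minors_nonneg p m (\<lambda>i j. C i (?k j))"
        using minors_nonneg_select[OF C, of p "\<lambda>i. i" m ?k] k
        by (auto simp: strict_mono_on_def)
      show "(\<Sum>j<m. C i (?k j) * d' (?k j)) = y i" if "i < p" for i
      proof -
        have "(\<Sum>j<m. C i (?k j) * d' (?k j)) = (\<Sum>j\<in>{..<n} - {z}. C i j * d' j)"
          using sum.reindex[OF k(3), of "\<lambda>j. C i j * d' j"] k(2) by simp
        also have "\<dots> = (\<Sum>j<n. C i j * d' j)"
          using z by (intro sum.mono_neutral_left) auto
        finally show ?thesis using eq'[OF that] by simp
      qed
    qed (use m y in auto)
    then obtain h where h: "strict_mono_on {..<p} h" "h ` {..<p} \<subseteq> {..<m}"
      "\<And>i. i < p \<Longrightarrow> sgn (d' (?k (h i))) = sgn (y i)" by blast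
    have "strict_mono_on {..<p} (?k \<circ> h)" "(?k \<circ> h) ` {..<p} \<subseteq> {..<n}"
      using h(1,2) k(1,2) by (auto simp: strict_mono_on_def image_subset_iff)
    moreover have "sgn (d (?k (h i))) = sgn (y i)" if "i < p" for i
    proof -
      have "y i \<noteq> 0" using y that by (simp add: alternating_def)
      then have "d' (?k (h i)) \<noteq> 0" using h(3)[OF that] by (auto simp: sgn_0_0)
      moreover have "?k (h i) < n" using \<open>(?k \<circ> h) ` {..<p} \<subseteq> {..<n}\<close> that by auto
      ultimately show ?thesis using d' h(3)[OF that] by simp
    qed
    ultimately show ?thesis by (intro exI[of _ "?k \<circ> h"]) auto
  qed
  consider "\<exists>z<n. d z = 0" | "p < n \<or> p = n \<and> det (mat n n (\<lambda>(i, j). C i j)) = 0"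
    | "\<forall>z<n. d z \<noteq> 0" "p = n" "det (mat n n (\<lambda>(i, j). C i j)) \<noteq> 0"
    | "\<forall>z<n. d z \<noteq> 0" "n < p"
    by (metis linorder_less_linear)
  then show ?case
  proof cases
    case 1
    then obtain z where "z < n" "d z = 0" by blast
    then show ?thesis using eq by (intro drop[of z d]) auto
  next
    case 2
    then obtain e j where e: "\<And>i. i < p \<Longrightarrow> (\<Sum>j<n. C i j * e j) = 0" "j < n" "e j \<noteq> 0"
      by (rule singular_columns) blast
    obtain t z where tz: "z \<in> {..<n}" "d z - t * e z = 0"
      "\<And>j. j \<in> {..<n} \<Longrightarrow> d j - t * e j \<noteq> 0 \<Longrightarrow> sgn (d j - t * e j) = sgn (d j)"
      using shift_to_zero[of "{..<n}" j e d] e(2,3) by (metis finite_lessThan lessThan_iff)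
    have "(\<Sum>j<n. C i j * (d j - t * e j)) = y i" if "i < p" for i
    proof -
      have "(\<Sum>j<n. C i j * (d j - t * e j)) = (\<Sum>j<n. C i j * d j) - t * (\<Sum>j<n. C i j * e j)"
        by (simp add: algebra_simps sum_subtractf sum_distrib_left)
      then show ?thesis using eq e(1) that by simp
    qed
    then show ?thesis using tz by (intro drop[of z "\<lambda>j. d j - t * e j"]) auto
  next
    case 3
    then show ?thesis using sgn_solution_nonsingular[of n C d y] C eq y
      by (intro exI[of _ id]) (auto simp: strict_mono_on_def)
  next
    case 4
    \<comment> \<open>By induction each block of \<open>n\<close> consecutive rows forces its signs
      onto \<open>d\<close>, because the selection of columns is the identity. The blocks starting
      at rows 0 and 1 then clash at \<open>d 0\<close>.\<close>
    have block: "sgn (d i) = sgn (y (k + i))" if k: "k + n \<le> p" and i: "i < n" for k i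
    proof -
      have "\<exists>h. strict_mono_on {..<n} h \<and> h ` {..<n} \<subseteq> {..<n} \<and>
          (\<forall>i<n. sgn (d (h i)) = sgn (y (k + i)))"
      proof (rule less.hyps)
        show "minors_nonneg n n (\<lambda>i j. C (k + i) j)"
          using minors_nonneg_select[OF C, of n "\<lambda>i. k + i" n "\<lambda>j. j"] k 4(2)
          by (auto simp: strict_mono_on_def image_subset_iff)
        show "(\<Sum>j<n. C (k + i) j * d j) = y (k + i)" if "i < n" for i
          using eq[of "k + i"] that k by simp
        show "alternating n (\<lambda>i. y (k + i))" using k by (intro alternating_shift[OF y]) auto
      qed (use 4 in auto)
      then show ?thesis using strict_mono_on_eq_id i by metis
    qed
    \<comment> \<open>An empty sum would give \<open>y 0 = 0\<close>, so there is at least one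
      column.\<close>
    have "y 0 \<noteq> 0" using y 4(2) by (simp add: alternating_def)
    with eq[of 0] 4(2) have "0 < n" by (cases n) auto
    with block[of 0 0] block[of 1 0] 4(2) have "sgn (y 0) = sgn (y 1)" by simp
    moreover have "sgn (y 1) = - sgn (y 0)" using y 4(2) \<open>0 < n\<close> by (simp add: alternating_def)
    ultimately have "y 0 = 0" by (simp add: sgn_0_0)
    with \<open>y 0 \<noteq> 0\<close> show ?thesis by simp
  qed
qed


section \<open>Sign changes in lists and alternating selections\<close>

text \<open>Separated from the deletion of zeros, so that it applies both to
  \<open>nonzeros v\<close> and to the full entry list of a vector without zeros.\<close>

definition sign_changes :: "real list \<Rightarrow> nat" where
  "sign_changes l = card {i. Suc i < length l \<and> sgn (l ! i) \<noteq> sgn (l ! Suc i)}"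

lemma S_minus_sign_changes: "S_minus v = sign_changes (nonzeros v)"
  by (simp add: S_minus_def sign_changes_def)

lemma sign_changes_Cons:
  "sign_changes (a # b # l) = (if sgn a = sgn b then 0 else 1) + sign_changes (b # l)"
proof -
  let ?S = "\<lambda>l. {i. Suc i < length l \<and> sgn (l ! i) \<noteq> sgn (l ! Suc i)}"
  have fin: "finite (?S l)" for l :: "real list"
    by (rule finite_subset[of _ "{..<length l}"]) auto
  have "?S (a # b # l) = (if sgn a = sgn b then {} else {0}) \<union> Suc ` ?S (b # l)" (is "?L = ?R")
  proof (rule Set.set_eqI)
    show "i \<in> ?L \<longleftrightarrow> i \<in> ?R" for i by (cases i) auto
  qed
  then show ?thesis
    unfolding sign_changes_def using fin[of "b # l"]
    by (simp add: card_image)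
qed

text \<open>Turns a selection from the tail of a list into one from the whole list that also takes
  the head.\<close>

lemma strict_mono_on_case_nat:
  fixes g :: "nat \<Rightarrow> nat"
  assumes "strict_mono_on {..<n} g" "g ` {..<n} \<subseteq> {..<N}"
  shows "strict_mono_on {..<Suc n} (case_nat 0 (Suc \<circ> g))"
    and "case_nat 0 (Suc \<circ> g) ` {..<Suc n} \<subseteq> {..<Suc N}"
proof -
  show "strict_mono_on {..<Suc n} (case_nat 0 (Suc \<circ> g))"
  proof (rule strict_mono_onI)
    fix i j assume "i \<in> {..<Suc n}" "j \<in> {..<Suc n}" "i < j"
    then show "case_nat 0 (Suc \<circ> g) i < case_nat 0 (Suc \<circ> g) j"
      using assms(1) by (cases i; cases j) (auto simp: strict_mono_on_def)
  qed
  show "case_nat 0 (Suc \<circ> g) ` {..<Suc n} \<subseteq> {..<Suc N}"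
  proof (rule image_subsetI)
    fix i assume "i \<in> {..<Suc n}"
    then show "case_nat 0 (Suc \<circ> g) i \<in> {..<Suc N}" using assms(2) by (cases i) auto
  qed
qed

lemma alternating_Suc:
  assumes "alternating (Suc p) (\<lambda>i. y (Suc i))" "y 0 \<noteq> 0" "sgn (y (Suc 0)) = - sgn (y 0)"
  shows "alternating (Suc (Suc p)) y"
  unfolding alternating_def
proof (intro conjI allI impI)
  show "y i \<noteq> 0" if "i < Suc (Suc p)" for i
    using assms that by (cases i) (auto simp: alternating_def)
  show "sgn (y (Suc i)) = - sgn (y i)" if "Suc i < Suc (Suc p)" for i
    using assms that by (cases i) (auto simp: alternating_def)
qed

text \<open>The last entry of each maximal run of equal signs is selected; there is one more run
  than there are sign changes.\<close>

lemma alternating_selection: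
  assumes "l \<noteq> []" "0 \<notin> set l"
  shows "\<exists>f. strict_mono_on {..sign_changes l} f \<and> f ` {..sign_changes l} \<subseteq> {..<length l} \<and>
           alternating (Suc (sign_changes l)) (\<lambda>i. l ! f i) \<and>
           sgn (l ! f 0) = sgn (hd l) \<and> sgn (l ! f (sign_changes l)) = sgn (last l)"
  using assms
proof (induction l rule: induct_list012)
  case (2 a)
  then show ?case
    by (intro exI[of _ id]) (auto simp: sign_changes_def strict_mono_on_def alternating_def)
next
  case (3 a b l)
  let ?m = "sign_changes (b # l)"
  obtain f where f: "strict_mono_on {..?m} f" "f ` {..?m} \<subseteq> {..<length (b # l)}"
    "alternating (Suc ?m) (\<lambda>i. (b # l) ! f i)"
    "sgn ((b # l) ! f 0) = sgn b" "sgn ((b # l) ! f ?m) = sgn (last (b # l))"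
    using 3 by auto
  show ?case
  proof (cases "sgn a = sgn b")
    \<comment> \<open>The head joins the run of \<open>b\<close>, which already has a
      representative.\<close>
    case True
    then have m: "sign_changes (a # b # l) = ?m" by (simp add: sign_changes_Cons)
    show ?thesis unfolding m
      by (rule exI[of _ "Suc \<circ> f"])
        (use f True in \<open>auto simp: strict_mono_on_def image_subset_iff alternating_def\<close>)
  next
    case False
    then have m: "sign_changes (a # b # l) = Suc ?m" by (simp add: sign_changes_Cons)
    have ab: "sgn b = - sgn a" "a \<noteq> 0" using False 3(4) by (auto simp: sgn_if split: if_splits)
    have "alternating (Suc (Suc ?m)) (\<lambda>i. (a # b # l) ! case_nat 0 (Suc \<circ> f) i)"
      using f ab by (intro alternating_Suc) simp_all
    then show ?thesis unfolding m
      using strict_mono_on_case_nat[of "Suc ?m" f "length (b # l)"] f ab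
      by (intro exI[of _ "case_nat 0 (Suc \<circ> f)"]) (simp add: lessThan_Suc_atMost)
  qed
qed simp

text \<open>Composed with a selection from \<open>nonzeros v\<close>, this embedding gives a
  selection of coordinates of \<open>v\<close>.\<close>

lemma filter_embedding:
  "\<exists>g. strict_mono_on {..<length (filter P l)} g \<and> g ` {..<length (filter P l)} \<subseteq> {..<length l} \<and>
     (\<forall>i<length (filter P l). filter P l ! i = l ! g i)"
proof (induction l)
  case (Cons a l)
  then obtain g where g: "strict_mono_on {..<length (filter P l)} g"
    "g ` {..<length (filter P l)} \<subseteq> {..<length l}"
    "\<forall>i<length (filter P l). filter P l ! i = l ! g i" by blast
  show ?case
  proof (cases "P a")
    case True
    have "filter P (a # l) ! i = (a # l) ! case_nat 0 (Suc \<circ> g) i"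
      if "i < length (filter P (a # l))" for i
      using that g(3) True by (cases i) auto
    then show ?thesis
      using strict_mono_on_case_nat[OF g(1,2)] True
      by (intro exI[of _ "case_nat 0 (Suc \<circ> g)"]) simp
  next
    case False
    then show ?thesis using g
      by (intro exI[of _ "Suc \<circ> g"]) (auto simp: strict_mono_on_def image_subset_iff)
  qed
qed (simp add: strict_mono_on_def)

text \<open>The number of sign changes to the left of an index increases strictly along an alternating
  selection.\<close>

lemma alternating_selection_bound:
  assumes h: "strict_mono_on {..m} h" "h ` {..m} \<subseteq> {..<length l}"
    and alt: "alternating (Suc m) (\<lambda>i. l ! h i)"
  shows "m \<le> sign_changes l"
    and "m = sign_changes l \<Longrightarrow> sgn (l ! h 0) = sgn (l ! 0)"
    and "m = sign_changes l \<Longrightarrow> sgn (l ! h m) = sgn (l ! (length l - 1))"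
proof -
  define D where "D i = {t. t < i \<and> sgn (l ! t) \<noteq> sgn (l ! Suc t)}" for i
  have fin: "finite (D i)" for i by (rule finite_subset[of _ "{..<i}"]) (auto simp: D_def)
  have mono: "card (D i) \<le> card (D j)" if "i \<le> j" for i j
    using that by (intro card_mono fin) (auto simp: D_def)
  have strict: "card (D i) < card (D j)" if "i \<le> j" "sgn (l ! i) \<noteq> sgn (l ! j)" for i j
  proof -
    have "\<exists>t. i \<le> t \<and> t < j \<and> sgn (l ! t) \<noteq> sgn (l ! Suc t)"
    proof (rule ccontr)
      assume *: "\<not> ?thesis"
      have "k \<le> j - i \<Longrightarrow> sgn (l ! (i + k)) = sgn (l ! i)" for k
      proof (induction k)
        case (Suc k)
        with * have "sgn (l ! (i + k)) = sgn (l ! Suc (i + k))" by auto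
        with Suc show ?case by simp
      qed simp
      from this[of "j - i"] that show False by simp
    qed
    then obtain t where "i \<le> t" "t < j" "sgn (l ! t) \<noteq> sgn (l ! Suc t)" by blast
    then have "t \<in> D j" "t \<notin> D i" by (simp_all add: D_def)
    moreover have "D i \<subseteq> D j" using that(1) by (auto simp: D_def)
    ultimately have "D i \<subset> D j" by blast
    then show ?thesis by (intro psubset_card_mono fin)
  qed
  have step: "card (D (h 0)) + k \<le> card (D (h k))" if "k \<le> m" for k
    using that
  proof (induction k)
    case (Suc k)
    have "sgn (l ! h k) \<noteq> sgn (l ! h (Suc k))"
      using alt Suc.prems by (auto simp: alternating_def sgn_0_0)
    moreover have "h k \<le> h (Suc k)" using h(1) Suc.prems by (simp add: strict_mono_on_def less_imp_le)
    ultimately show ?case using strict Suc by fastforce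
  qed simp
  have hm: "h m < length l" using h(2) by auto
  have last: "card (D (length l - 1)) = sign_changes l"
    unfolding sign_changes_def D_def by (rule arg_cong[of _ _ card]) auto
  \<comment> \<open>If \<open>m\<close> equals the number of sign changes, both inequalities are
    tight: no change lies before \<open>h 0\<close> and none after \<open>h m\<close>, which fixes
    the two end signs.\<close>
  have le: "card (D (h 0)) + m \<le> card (D (h m))" "card (D (h m)) \<le> sign_changes l"
    using step[of m] mono[of "h m" "length l - 1"] hm last by auto
  then show "m \<le> sign_changes l" by simp
  show "sgn (l ! h 0) = sgn (l ! 0)" if "m = sign_changes l"
    using le that strict[of 0 "h 0"] by fastforce
  show "sgn (l ! h m) = sgn (l ! (length l - 1))" if "m = sign_changes l"
  proof (rule ccontr)
    assume "sgn (l ! h m) \<noteq> sgn (l ! (length l - 1))"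
    moreover have "h m \<le> length l - 1" using hm by simp
    ultimately have "card (D (h m)) < sign_changes l" using strict last by metis
    with le that show False by simp
  qed
qed

section \<open>From submatrices to arrays of selected rows\<close>

text \<open>\<open>pick\<close> returns the element with exactly \<open>i\<close> smaller ones, and
  below \<open>f i\<close> the image contains just the values of \<open>f\<close> at the
  \<open>i\<close> smaller indices.\<close>

lemma pick_image_strict_mono:
  assumes f: "strict_mono_on {..<l} f" and i: "i < l"
  shows "pick (f ` {..<l}) i = f i"
proof -
  have "{a \<in> f ` {..<l}. a < f i} = f ` {..<i}"
    using f i by (auto simp: strict_mono_on_less)
  moreover have "card (f ` {..<i}) = i"
    using strict_mono_on_imp_inj_on[OF f] i
    by (subst card_image) (auto intro: inj_on_subset)
  ultimately show ?thesis using pick_card_in_set[of "f i" "f ` {..<l}"] i by simp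
qed

text \<open>An array of \<open>p \<le> k\<close> rows has only minors of order at most
  \<open>k\<close>. So as long as few enough rows are selected, the bound on the order in
  \<open>totally_nonneg\<close> is invisible.\<close>

lemma totally_nonneg_minors_nonneg:
  assumes A: "totally_nonneg k A" "A \<in> carrier_mat n m"
    and f: "strict_mono_on {..<p} f" "f ` {..<p} \<subseteq> {..<n}" and "p \<le> k"
  shows "minors_nonneg p m (\<lambda>i j. A $$ (f i, j))"
  unfolding minors_nonneg_def
proof (intro allI impI, elim conjE)
  fix l :: nat and u v
  assume u: "strict_mono_on {..<l} u" "u ` {..<l} \<subseteq> {..<p}"
    and v: "strict_mono_on {..<l} v" "v ` {..<l} \<subseteq> {..<m}"
  define I where "I = (f \<circ> u) ` {..<l}"
  define J where "J = v ` {..<l}"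
  have fu: "strict_mono_on {..<l} (f \<circ> u)"
    using f u by (auto simp: strict_mono_on_def image_subset_iff)
  have I: "I \<subseteq> {..<n}" "card I = l"
    using f u card_image[OF strict_mono_on_imp_inj_on[OF fu]]
    by (auto simp: I_def image_subset_iff)
  have J: "J \<subseteq> {..<m}" "card J = l"
    using v by (auto simp: J_def image_subset_iff card_image strict_mono_on_imp_inj_on)
  have "l = card (u ` {..<l})" using u by (simp add: card_image strict_mono_on_imp_inj_on)
  also have "\<dots> \<le> p" using card_mono[OF _ u(2)] by simp
  finally have "l \<le> k" using \<open>p \<le> k\<close> by simp
  then have "0 \<le> det (submatrix A I J)"
    using A I J by (auto simp: totally_nonneg_def)
  also have "{i. i < n \<and> i \<in> I} = I" "{j. j < m \<and> j \<in> J} = J" using I J by auto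
  then have "submatrix A I J = mat l l (\<lambda>(i, j). A $$ (f (u i), v j))"
    using A(2) I J pick_image_strict_mono[OF fu, folded I_def]
      pick_image_strict_mono[OF v(1), folded J_def]
    by (auto simp: submatrix_def intro!: eq_matI)
  finally show "0 \<le> det (mat l l (\<lambda>(i, j). A $$ (f (u i), v j)))" .
qed

lemma totally_nonneg_alternating:
  assumes A: "totally_nonneg k A" "A \<in> carrier_mat n m" and x: "x \<in> carrier_vec m"
    and f: "strict_mono_on {..<p} f" "f ` {..<p} \<subseteq> {..<n}" and "p \<le> k"
    and alt: "alternating p (\<lambda>i. (A *\<^sub>v x) $ f i)"
  shows "\<exists>h. strict_mono_on {..<p} h \<and> h ` {..<p} \<subseteq> {..<m} \<and>
           (\<forall>i<p. sgn (x $ h i) = sgn ((A *\<^sub>v x) $ f i))"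
proof (rule alternating_product_pattern[OF totally_nonneg_minors_nonneg[OF A f \<open>p \<le> k\<close>] _ alt])
  fix i assume "i < p"
  then have "f i < n" using f by auto
  then show "(\<Sum>j<m. A $$ (f i, j) * x $ j) = (A *\<^sub>v x) $ f i"
    using A x by (simp add: scalar_prod_def lessThan_atLeast0)
qed


section \<open>Comparing the sign changes of \<open>x\<close> and \<open>A x\<close>\<close>

text \<open>Some adjacent pair of coordinates has equal signs, so at most \<open>r - 2\<close> of
  the \<open>r - 1\<close> pairs change sign. The form with \<open>+ 2\<close> also records that
  \<open>r\<close> is at least 2.\<close>

lemma sign_changes_not_alt:
  assumes "x \<in> carrier_vec r - alt_vecs r" "\<And>i. i < r \<Longrightarrow> x $ i \<noteq> 0"
  shows "sign_changes (list_of_vec x) + 2 \<le> r"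
proof -
  have x: "x \<in> carrier_vec r" using assms(1) by simp
  obtain k where k: "Suc k < r" "sgn (x $ Suc k) \<noteq> - sgn (x $ k)"
    using assms by (auto simp: alt_vecs_def)
  with assms(2)[of k] assms(2)[of "Suc k"] have "sgn (x $ k) = sgn (x $ Suc k)"
    by (auto simp: sgn_if split: if_splits)
  with x have "{i. Suc i < length (list_of_vec x) \<and>
      sgn (list_of_vec x ! i) \<noteq> sgn (list_of_vec x ! Suc i)} \<subseteq> {..<r - 1} - {k}"
    by (auto simp: list_of_vec_index)
  then have "sign_changes (list_of_vec x) \<le> card ({..<r - 1} - {k})"
    unfolding sign_changes_def by (intro card_mono) auto
  then show ?thesis using k by simp
qed

lemma nonzeros_eq_list_of_vec:
  assumes "v \<in> carrier_vec r" "\<And>i. i < r \<Longrightarrow> v $ i \<noteq> 0"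
  shows "nonzeros v = list_of_vec v"
  unfolding nonzeros_def using assms
  by (intro filter_True) (auto simp: set_list_of_vec vec_set_def)

lemma nonzeros_alternating_selection:
  assumes "y \<in> carrier_vec r" "y \<noteq> 0\<^sub>v r"
  obtains f where "strict_mono_on {..S_minus y} f" "f ` {..S_minus y} \<subseteq> {..<r}"
    "alternating (Suc (S_minus y)) (\<lambda>i. y $ f i)"
    "sgn (y $ f 0) = sgn (hd (nonzeros y))" "sgn (y $ f (S_minus y)) = sgn (last (nonzeros y))"
proof -
  let ?l = "nonzeros y" and ?m = "S_minus y"
  obtain i where "i < r" "y $ i \<noteq> 0" using assms by (metis eq_vecI carrier_vecD index_zero_vec)
  then have "y $ i \<in> set ?l"
    using assms(1) by (auto simp: nonzeros_def set_list_of_vec vec_set_def)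
  then have "?l \<noteq> []" by auto
  have "0 \<notin> set ?l" by (simp add: nonzeros_def)
  from alternating_selection[OF \<open>?l \<noteq> []\<close> this] obtain f where f: "strict_mono_on {..?m} f"
    "f ` {..?m} \<subseteq> {..<length ?l}" "alternating (Suc ?m) (\<lambda>i. ?l ! f i)"
    "sgn (?l ! f 0) = sgn (hd ?l)" "sgn (?l ! f ?m) = sgn (last ?l)"
    unfolding S_minus_sign_changes by blast
  obtain g where g: "strict_mono_on {..<length ?l} g" "g ` {..<length ?l} \<subseteq> {..<r}"
    "\<And>i. i < length ?l \<Longrightarrow> ?l ! i = y $ g i"
    using filter_embedding[of "\<lambda>a. a \<noteq> 0" "list_of_vec y"] assms(1)
    by (auto simp: nonzeros_def list_of_vec_index)
  have fg: "?l ! f i = y $ (g \<circ> f) i" if "i \<le> ?m" for i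
    using f(2) g(3) that by auto
  show ?thesis
  proof
    show "strict_mono_on {..?m} (g \<circ> f)" "(g \<circ> f) ` {..?m} \<subseteq> {..<r}"
      using f(1,2) g(1,2) by (auto simp: strict_mono_on_def image_subset_iff)
    show "alternating (Suc ?m) (\<lambda>i. y $ (g \<circ> f) i)"
      using f(3) fg by (auto simp: alternating_def simp del: o_apply)
  qed (use f(4,5) fg in auto)
qed

text \<open>The \<open>Suc m \<le> k\<close> selected entries of the image reappear, with the same
  signs, as a selection from \<open>x\<close>. The bound for alternating selections in
  \<open>x\<close> and its equality case therefore carry over.\<close>

lemma sign_changes_totally_nonneg:
  assumes A: "totally_nonneg k A" "A \<in> carrier_mat n r" and x: "x \<in> carrier_vec r"
    and f: "strict_mono_on {..m} f" "f ` {..m} \<subseteq> {..<n}" and "m < k"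
    and alt: "alternating (Suc m) (\<lambda>i. (A *\<^sub>v x) $ f i)"
  defines "s \<equiv> sign_changes (list_of_vec x)"
  shows "m \<le> s"
    and "m = s \<Longrightarrow> sgn ((A *\<^sub>v x) $ f 0) = sgn (x $ 0)"
    and "m = s \<Longrightarrow> sgn ((A *\<^sub>v x) $ f m) = sgn (x $ (r - 1))"
proof -
  obtain h where h: "strict_mono_on {..m} h" "h ` {..m} \<subseteq> {..<r}"
    "\<And>i. i \<le> m \<Longrightarrow> sgn (x $ h i) = sgn ((A *\<^sub>v x) $ f i)"
    using totally_nonneg_alternating[OF A x, of "Suc m" f] f alt \<open>m < k\<close>
    unfolding lessThan_Suc_atMost less_Suc_eq_le by auto
  have "x $ h i \<noteq> 0" if "i \<le> m" for i
    using alt h(3)[OF that] that by (auto simp: alternating_def sgn_0_0)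
  then have "alternating (Suc m) (\<lambda>i. list_of_vec x ! h i)"
    using alt h(3) by (simp add: alternating_def list_of_vec_index less_Suc_eq_le)
  moreover have "h ` {..m} \<subseteq> {..<length (list_of_vec x)}" using h(2) x by simp
  ultimately have "m \<le> s" "m = s \<Longrightarrow> sgn (x $ h 0) = sgn (x $ 0)"
    "m = s \<Longrightarrow> sgn (x $ h m) = sgn (x $ (r - 1))"
    using alternating_selection_bound[OF h(1), of "list_of_vec x"] x
    by (simp_all add: s_def list_of_vec_index)
  then show "m \<le> s" "m = s \<Longrightarrow> sgn ((A *\<^sub>v x) $ f 0) = sgn (x $ 0)"
    "m = s \<Longrightarrow> sgn ((A *\<^sub>v x) $ f m) = sgn (x $ (r - 1))"
    using h(3)[of 0] h(3)[of m] by simp_all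
qed

theorem theorem5p3:
  fixes r :: nat and x :: "real vec" and A :: "real mat"
  assumes "x \<in> carrier_vec r - alt_vecs r"
    and "\<And>i. i < r \<Longrightarrow> x $ i \<noteq> 0"
    and "A \<in> carrier_mat r r"
    and "totally_nonneg (r - 1) A"
  shows "S_minus (A *\<^sub>v x) \<le> S_minus x \<and>
         (S_minus (A *\<^sub>v x) = S_minus x \<and> A *\<^sub>v x \<noteq> 0\<^sub>v r \<longrightarrow>
            sgn (hd (nonzeros (A *\<^sub>v x))) = sgn (x $ 0) \<and>
            sgn (last (nonzeros (A *\<^sub>v x))) = sgn (x $ (r - 1))) \<and>
         (\<exists>i<r. x $ i * (A *\<^sub>v x) $ i \<ge> 0)"
proof -
  let ?y = "A *\<^sub>v x"
  have x: "x \<in> carrier_vec r" using assms(1) by simp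
  have y: "?y \<in> carrier_vec r" using assms(3) x by simp
  have Sx: "S_minus x = sign_changes (list_of_vec x)"
    by (simp add: S_minus_sign_changes nonzeros_eq_list_of_vec[OF x assms(2)])
  have Sx2: "S_minus x + 2 \<le> r" using sign_changes_not_alt[OF assms(1,2)] Sx by simp
  note bound = sign_changes_totally_nonneg[OF assms(4,3) x, folded Sx]
  have *: "S_minus ?y \<le> S_minus x \<and> (S_minus ?y = S_minus x \<longrightarrow>
      sgn (hd (nonzeros ?y)) = sgn (x $ 0) \<and> sgn (last (nonzeros ?y)) = sgn (x $ (r - 1)))"
    if "?y \<noteq> 0\<^sub>v r"
  proof -
    obtain f where f: "strict_mono_on {..S_minus ?y} f" "f ` {..S_minus ?y} \<subseteq> {..<r}"
      "alternating (Suc (S_minus ?y)) (\<lambda>i. ?y $ f i)"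
      "sgn (?y $ f 0) = sgn (hd (nonzeros ?y))"
      "sgn (?y $ f (S_minus ?y)) = sgn (last (nonzeros ?y))"
      using nonzeros_alternating_selection[OF y \<open>?y \<noteq> 0\<^sub>v r\<close>] by blast
    show ?thesis
    proof (cases "S_minus ?y < r - 1")
      case True
      then show ?thesis using bound[OF f(1,2) True f(3)] f(4,5) by metis
    next
      case False
      \<comment> \<open>An alternating image is excluded by its first and its last \<open>r - 1\<close> entries, which
        would both start with the sign of \<open>x $ 0\<close>.\<close>
      define q where "q = r - 2"
      have q: "Suc q \<le> S_minus ?y" "q < r - 1" "S_minus x \<le> q"
        using False Sx2 by (auto simp: q_def)
      have part: "sgn (?y $ f k) = sgn (x $ 0)" if "k \<le> 1" for k
      proof -
        have f': "strict_mono_on {..q} (\<lambda>i. f (k + i))" "(\<lambda>i. f (k + i)) ` {..q} \<subseteq> {..<r}"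
          using f(1,2) q that by (auto simp: strict_mono_on_def image_subset_iff)
        have "alternating (Suc q) (\<lambda>i. ?y $ f (k + i))"
          using q that by (intro alternating_shift[OF f(3)]) auto
        \<comment> \<open>The bound gives \<open>q \<le> S_minus x\<close>; with
          \<open>S_minus x \<le> q\<close> this is the equality case, which fixes the first
          sign.\<close>
        from bound[OF f' q(2) this] show ?thesis using q(3) by simp
      qed
      have "sgn (?y $ f 1) = - sgn (?y $ f 0)" "?y $ f 0 \<noteq> 0"
        using f(3) q(1) by (auto simp: alternating_def)
      with part[of 0] part[of 1] have False by (simp add: sgn_0_0)
      then show ?thesis ..
    qed
  qed
  have "\<exists>i<r. 0 \<le> x $ i * ?y $ i"
  proof (rule ccontr)
    assume "\<not> ?thesis"
    then have neg: "x $ i * ?y $ i < 0" if "i < r" for i using that by force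
    have "?y \<noteq> 0\<^sub>v r" using neg[of 0] Sx2 by auto
    have sgn: "sgn (?y $ i) = - sgn (x $ i)" if "i < r" for i
      using neg[OF that] by (auto simp: sgn_if mult_less_0_iff)
    have "?y $ i \<noteq> 0" if "i < r" for i using neg[OF that] by auto
    then have "nonzeros ?y = list_of_vec ?y" by (rule nonzeros_eq_list_of_vec[OF y])
    \<comment> \<open>Reversing every sign preserves which adjacent pairs differ.\<close>
    moreover have "sign_changes (list_of_vec ?y) = sign_changes (list_of_vec x)"
      unfolding sign_changes_def using x y sgn
      by (intro arg_cong[of _ _ card])
        (auto simp: list_of_vec_index simp del: index_mult_mat_vec dim_mult_mat_vec)
    moreover have "hd (list_of_vec ?y) = ?y $ 0"
    proof -
      have "length (list_of_vec ?y) = r" unfolding length_list_of_vec using y by (rule carrier_vecD)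
      then have "list_of_vec ?y \<noteq> []" using Sx2 by (metis add_2_eq_Suc' list.size(3) not_less_eq_eq zero_le)
      then show ?thesis by (metis hd_conv_nth list_of_vec_index)
    qed
    ultimately have "sgn (?y $ 0) = sgn (x $ 0)"
      using *[OF \<open>?y \<noteq> 0\<^sub>v r\<close>] Sx by (simp add: S_minus_sign_changes)
    with sgn[of 0] assms(2)[of 0] Sx2 show False by (simp add: sgn_0_0)
  qed
  \<comment> \<open>A zero image has an empty list of nonzero entries, hence no sign
    changes.\<close>
  moreover have "S_minus ?y \<le> S_minus x" if "?y = 0\<^sub>v r"
    by (simp add: that S_minus_def nonzeros_def)
  ultimately show ?thesis using * by blast
qed

end
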